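(* Let $r_p,h_p,r_v,a_{lo},a_{up},a_{max},c,\epsilon$ be real parameters and $r,h,v,w,v_{lo},v_{up},t$ real state variables. The following differential game logic formula is valid: $$\Big(r_p\ge0\wedge h_p>0\wedge r_v\ge0\wedge a_{lo}>0\wedge(w=-1\vee w=1)\wedge a_{up}>a_{lo}+2c\wedge\epsilon\ge0\wedge a_{max}\ge a_{lo}\wedge C^{safeable(\epsilon)}_{impl}(r,h,v,w,v_{lo},v_{up})\Big)\to[\alpha_6^*]\big(|r|>r_p\vee|h|>h_p\big),$$ where $$\alpha_6\equiv(w:=1\cup w:=-1);\ v_{lo}:=*;\ v_{up}:=*;\ ?C^{safeable(\epsilon)}_{impl}(r,h,v,w,v_{lo},v_{up});\ \mathit{adv}:=(w,v_{lo},v_{up});\ t:=0;\ \Big((a_o:=*;\ ?(-a_{max}\le a_o\le a_{max}))^d;\ \{r'=-r_v,h'=-v,v'=a_o,t'=1\ \&\ t\le\epsilon\wedge((wa_o\le0\vee wv\le wv_{up})\cup(wa_o\ge0\wedge wv\ge wv_{up}))\}\Big)^*.$$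
   Context: Game semantics (differential game logic dGL). A hybrid game is played between the ownship (the player who must establish the postcondition) and the opponent. $P\to[\alpha]Q$ is valid iff from every state satisfying $P$ the ownship has a strategy in $\alpha$ such that every play it allows ends (whenever it ends) in a state satisfying $Q$. Constructs: $x:=e$ assigns; $x:=*$ opponent picks any real value; $?\phi$ test: if false the opponent loses; $\alpha;\beta$ sequential; $\alpha\cup\beta$ opponent chooses; $\alpha^*$ opponent decides before each round whether to continue or stop ($Q$ must hold after every finite number of rounds, including zero); $\{x'=f(x)\ \&\ D\}$ follows the ODE for a nonnegative duration chosen by the opponent with $D$ true throughout; $\{x'=f(x)\ \&\ P\wedge(Q_1\cup Q_2)\}$ abbreviates $\{x'=f(x)\ \&\ P\wedge Q_1\}\cup\{x'=f(x)\ \&\ P\wedge Q_2\}$; $\alpha^d$ swaps roles: inside, the ownship makes all choices and a failed test makes the ownship lose. $\mathit{adv}:=(\dots)$ is a bookkeeping assignment to a variable not occurring elsewhere. ($c$ is a real parameter appearing only in the precondition.) Auxiliary definitions: $T_{lo}(v,w,v_{lo})\equiv\frac{\max(0,w(v_{lo}-v))}{a_{lo}}$, $T_{up}(v,w,v_{up})\equiv\frac{\max(0,w(v_{up}-v))}{a_{up}}$; $A_{lo}(v,w,v_{lo},h_n,t)\equiv(0\le t<T_{lo}\wedge h_n=\frac{wa_{lo}}2t^2+vt)\vee(t\ge T_{lo}\wedge h_n=v_{lo}t-\frac{w\max(0,w(v_{lo}-v))^2}{2a_{lo}})$; $A_{up}(v,w,v_{up},h_n,t)\equiv(0\le t<T_{up}\wedge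 h_n=\frac{wa_{up}}2t^2+vt)\vee(t\ge T_{up}\wedge h_n=w\max(wv_{up},wv)t-\frac{w\max(0,w(v_{up}-v))^2}{2a_{up}})$; $L^{-1}_{impl}(r,h,v,w,v_{lo})\equiv\forall t\,\forall r_n\,\forall h_n(r_n=r_vt\wedge A_{lo}(v,w,v_{lo},h_n,t)\to(|r-r_n|>r_p\vee w(h_n-h)>h_p))$; $L^{\epsilon}_{impl}(r,h,v,w,v_{lo})\equiv\forall t\,\forall r_n\,\forall h_n((t\le\epsilon\vee\epsilon<0)\wedge r_n=r_vt\wedge A_{lo}(v,w,v_{lo},h_n,t)\to(|r-r_n|>r_p\vee w(h_n-h)>h_p))$; $U^{\epsilon}_{impl}(r,h,v,w,v_{up})\equiv\forall t\,\forall r_n\,\forall h_n((t\le\epsilon\vee\epsilon<0)\wedge r_n=r_vt\wedge A_{up}(v,w,v_{up},h_n,t)\to(|r-r_n|>r_p\vee w(h-h_n)>h_p))$. Safeable region: $L^{safeable(\epsilon)}_{impl}(r,h,v,w,v_{lo})\equiv L^{\epsilon}_{impl}(r,h,v,w,v_{lo})\wedge\forall h^{ex}_L\,\forall v^{ex}_L\Big(\big((0\le\epsilon<T_{lo}(v,w,v_{lo})\wedge h^{ex}_L=\frac{wa_{lo}}2\epsilon^2+v\epsilon\wedge v^{ex}_L=wa_{lo}\epsilon+v)\vee(\epsilon\ge T_{lo}(v,w,v_{lo})\wedge h^{ex}_L=v^{ex}_L\epsilon-\frac{w\max(0,w(v_{lo}-v))^2}{2a_{lo}}\wedge v^{ex}_L=v_{lo})\big)\to\exists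 v^{ex}_{lo}\,L^{-1}_{impl}(r-r_v\epsilon,h-h^{ex}_L,v^{ex}_L,w,v^{ex}_{lo})\Big)$; $U^{safeable(\epsilon)}_{impl}(r,h,v,w,v_{up})\equiv U^{\epsilon}_{impl}(r,h,v,w,v_{up})\wedge\forall h^{ex}_U\,\forall v^{ex}_U\Big(\big((0\le\epsilon<T_{up}(v,w,v_{up})\wedge h^{ex}_U=\frac{wa_{up}}2\epsilon^2+v\epsilon\wedge v^{ex}_U=wa_{up}\epsilon+v)\vee(\epsilon\ge T_{up}(v,w,v_{up})\wedge h^{ex}_U=v^{ex}_U\epsilon-\frac{w\max(0,w(v_{up}-v))^2}{2a_{up}}\wedge v^{ex}_U=w\max(wv_{up},wv))\big)\to\exists v^{ex}_{up}\,L^{-1}_{impl}(r-r_v\epsilon,h-h^{ex}_U,v^{ex}_U,-w,v^{ex}_{up})\Big)$; $C^{safeable(\epsilon)}_{impl}(r,h,v,w,v_{lo},v_{up})\equiv wv_{lo}\le wv_{up}\wedge(L^{safeable(\epsilon)}_{impl}(r,h,v,w,v_{lo})\vee U^{safeable(\epsilon)}_{impl}(r,h,v,w,v_{up}))$. Here $r_v,a_{lo},a_{up},r_p,h_p,\epsilon$ are the parameters. *)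

theory Defs
  imports Complex_Main
begin

section \<open>Differential game logic\<close>

text \<open>
  Terms and formulas are represented semantically, as functions and predicates on states;
  hybrid games are a datatype.
\<close>

type_synonym 'v state = "'v \<Rightarrow> real"

datatype 'v game =
    Assign 'v "'v state \<Rightarrow> real"                ("(_ :=\<^sub>g _)" [75, 75] 74)
  | AssignAny 'v                                 ("(_ :=\<^sub>g *)" [75] 74)
  | Test "'v state \<Rightarrow> bool"
  | Evolve "('v \<times> ('v state \<Rightarrow> real)) list" "'v state \<Rightarrow> bool"
  | Seq "'v game" "'v game"                      (infixr ";;" 60)
  | Choice "'v game" "'v game"                   (infixr "\<union>\<^sub>g" 65)
  | Loop "'v game"
  | Dual "'v game"

text \<open>
  \<open>\<phi>\<close> follows the differential equations for duration \<open>T\<close> from \<open>s\<close> inside the domain \<open>D\<close>.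
  Variables without an equation stay constant.  Derivatives are one-sided at the end points;
  for \<open>T = 0\<close> the derivative condition is void, but \<open>D\<close> still has to hold in \<open>s\<close>.
\<close>

definition solution ::
  "('v \<times> ('v state \<Rightarrow> real)) list \<Rightarrow> ('v state \<Rightarrow> bool) \<Rightarrow> 'v state \<Rightarrow> real \<Rightarrow> (real \<Rightarrow> 'v state) \<Rightarrow> bool"
where
  "solution ode D s T \<phi> \<longleftrightarrow>
     \<phi> 0 = s \<and>
     (\<forall>\<tau>\<in>{0..T}.
        (\<forall>(x, e)\<in>set ode. ((\<lambda>u. \<phi> u x) has_real_derivative e (\<phi> \<tau>)) (at \<tau> within {0..T})) \<and>
        (\<forall>x. x \<notin> fst ` set ode \<longrightarrow> \<phi> \<tau> x = s x) \<and>
        D (\<phi> \<tau>))"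

text \<open>
  The denotational (winning region) semantics of differential game logic.  In every game that
  is not below a \<open>Dual\<close> the opponent moves.  \<open>box \<alpha> X\<close> is the set of states from which the
  player who does \<^emph>\<open>not\<close> move at the top level of \<open>\<alpha>\<close> has a strategy to reach \<open>X\<close> whenever
  the play ends; \<open>dia \<alpha> X\<close> is the same for the player who does move there.  A loop is left
  only by decision of its mover, who loses if it is repeated forever: hence the greatest
  fixed point for \<open>box\<close> and the least one for \<open>dia\<close>.
\<close>

fun box :: "'v game \<Rightarrow> 'v state set \<Rightarrow> 'v state set"
and dia :: "'v game \<Rightarrow> 'v state set \<Rightarrow> 'v state set"
where
  "box (Assign x e) X = {s. s(x := e s) \<in> X}"
| "box (AssignAny x) X = {s. \<forall>a. s(x := a) \<in> X}"
| "box (Test P) X = {s. P s \<longrightarrow> s \<in> X}"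
| "box (Evolve ode D) X = {s. \<forall>T \<phi>. 0 \<le> T \<and> solution ode D s T \<phi> \<longrightarrow> \<phi> T \<in> X}"
| "box (Seq \<alpha> \<beta>) X = box \<alpha> (box \<beta> X)"
| "box (Choice \<alpha> \<beta>) X = box \<alpha> X \<inter> box \<beta> X"
| "box (Loop \<alpha>) X = gfp (\<lambda>Z. X \<inter> box \<alpha> Z)"
| "box (Dual \<alpha>) X = dia \<alpha> X"
| "dia (Assign x e) X = {s. s(x := e s) \<in> X}"
| "dia (AssignAny x) X = {s. \<exists>a. s(x := a) \<in> X}"
| "dia (Test P) X = {s. P s \<and> s \<in> X}"
| "dia (Evolve ode D) X = {s. \<exists>T \<phi>. 0 \<le> T \<and> solution ode D s T \<phi> \<and> \<phi> T \<in> X}"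
| "dia (Seq \<alpha> \<beta>) X = dia \<alpha> (dia \<beta> X)"
| "dia (Choice \<alpha> \<beta>) X = dia \<alpha> X \<union> dia \<beta> X"
| "dia (Loop \<alpha>) X = lfp (\<lambda>Z. X \<union> dia \<alpha> Z)"
| "dia (Dual \<alpha>) X = box \<alpha> X"

definition Box :: "'v game \<Rightarrow> ('v state \<Rightarrow> bool) \<Rightarrow> 'v state \<Rightarrow> bool"
where
  "Box \<alpha> Q = (\<lambda>s. s \<in> box \<alpha> {s'. Q s'})"

definition valid :: "('v state \<Rightarrow> bool) \<Rightarrow> bool"
where
  "valid F \<longleftrightarrow> (\<forall>s. F s)"

text \<open>\<open>{ode & P \<and> (Q1 \<union> Q2)}\<close>\<close>

definition EvolveSplit ::
  "('v \<times> ('v state \<Rightarrow> real)) list \<Rightarrow> ('v state \<Rightarrow> bool) \<Rightarrow> ('v state \<Rightarrow> bool) \<Rightarrow> ('v state \<Rightarrow> bool)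
     \<Rightarrow> 'v game"
where
  "EvolveSplit ode P Q1 Q2 = Evolve ode (\<lambda>s. P s \<and> Q1 s) \<union>\<^sub>g Evolve ode (\<lambda>s. P s \<and> Q2 s)"


section \<open>Safeable regions\<close>

definition T_lo :: "real \<Rightarrow> real \<Rightarrow> real \<Rightarrow> real \<Rightarrow> real"
where
  "T_lo a_lo v w v_lo = max 0 (w * (v_lo - v)) / a_lo"

definition T_up :: "real \<Rightarrow> real \<Rightarrow> real \<Rightarrow> real \<Rightarrow> real"
where
  "T_up a_up v w v_up = max 0 (w * (v_up - v)) / a_up"

definition A_lo :: "real \<Rightarrow> real \<Rightarrow> real \<Rightarrow> real \<Rightarrow> real \<Rightarrow> real \<Rightarrow> bool"
where
  "A_lo a_lo v w v_lo h_n t \<longleftrightarrow>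
     (0 \<le> t \<and> t < T_lo a_lo v w v_lo \<and> h_n = w * a_lo / 2 * t\<^sup>2 + v * t) \<or>
     (t \<ge> T_lo a_lo v w v_lo \<and>
      h_n = v_lo * t - w * (max 0 (w * (v_lo - v)))\<^sup>2 / (2 * a_lo))"

definition A_up :: "real \<Rightarrow> real \<Rightarrow> real \<Rightarrow> real \<Rightarrow> real \<Rightarrow> real \<Rightarrow> bool"
where
  "A_up a_up v w v_up h_n t \<longleftrightarrow>
     (0 \<le> t \<and> t < T_up a_up v w v_up \<and> h_n = w * a_up / 2 * t\<^sup>2 + v * t) \<or>
     (t \<ge> T_up a_up v w v_up \<and>
      h_n = w * max (w * v_up) (w * v) * t - w * (max 0 (w * (v_up - v)))\<^sup>2 / (2 * a_up))"

text \<open>The unbounded-time region, written with superscript \<open>-1\<close> in the literature.\<close>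

definition L_impl_inf ::
  "real \<Rightarrow> real \<Rightarrow> real \<Rightarrow> real \<Rightarrow> real \<Rightarrow> real \<Rightarrow> real \<Rightarrow> real \<Rightarrow> real \<Rightarrow> bool"
where
  "L_impl_inf r_p h_p r_v a_lo r h v w v_lo \<longleftrightarrow>
     (\<forall>t r_n h_n. r_n = r_v * t \<and> A_lo a_lo v w v_lo h_n t \<longrightarrow>
        \<bar>r - r_n\<bar> > r_p \<or> w * (h_n - h) > h_p)"

definition L_impl ::
  "real \<Rightarrow> real \<Rightarrow> real \<Rightarrow> real \<Rightarrow> real \<Rightarrow> real \<Rightarrow> real \<Rightarrow> real \<Rightarrow> real \<Rightarrow> real \<Rightarrow> bool"
where
  "L_impl r_p h_p r_v a_lo \<epsilon> r h v w v_lo \<longleftrightarrow>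
     (\<forall>t r_n h_n. (t \<le> \<epsilon> \<or> \<epsilon> < 0) \<and> r_n = r_v * t \<and> A_lo a_lo v w v_lo h_n t \<longrightarrow>
        \<bar>r - r_n\<bar> > r_p \<or> w * (h_n - h) > h_p)"

definition U_impl ::
  "real \<Rightarrow> real \<Rightarrow> real \<Rightarrow> real \<Rightarrow> real \<Rightarrow> real \<Rightarrow> real \<Rightarrow> real \<Rightarrow> real \<Rightarrow> real \<Rightarrow> bool"
where
  "U_impl r_p h_p r_v a_up \<epsilon> r h v w v_up \<longleftrightarrow>
     (\<forall>t r_n h_n. (t \<le> \<epsilon> \<or> \<epsilon> < 0) \<and> r_n = r_v * t \<and> A_up a_up v w v_up h_n t \<longrightarrow>
        \<bar>r - r_n\<bar> > r_p \<or> w * (h - h_n) > h_p)"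

definition L_safeable ::
  "real \<Rightarrow> real \<Rightarrow> real \<Rightarrow> real \<Rightarrow> real \<Rightarrow> real \<Rightarrow> real \<Rightarrow> real \<Rightarrow> real \<Rightarrow> real \<Rightarrow> bool"
where
  "L_safeable r_p h_p r_v a_lo \<epsilon> r h v w v_lo \<longleftrightarrow>
     L_impl r_p h_p r_v a_lo \<epsilon> r h v w v_lo \<and>
     (\<forall>h_ex v_ex.
        (0 \<le> \<epsilon> \<and> \<epsilon> < T_lo a_lo v w v_lo \<and>
           h_ex = w * a_lo / 2 * \<epsilon>\<^sup>2 + v * \<epsilon> \<and> v_ex = w * a_lo * \<epsilon> + v) \<or>
        (\<epsilon> \<ge> T_lo a_lo v w v_lo \<and>
           h_ex = v_ex * \<epsilon> - w * (max 0 (w * (v_lo - v)))\<^sup>2 / (2 * a_lo) \<and> v_ex = v_lo)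
        \<longrightarrow> (\<exists>v_lo_ex. L_impl_inf r_p h_p r_v a_lo (r - r_v * \<epsilon>) (h - h_ex) v_ex w v_lo_ex))"

text \<open>
  The continuation after time \<open>\<epsilon>\<close> is a lower-bound advisory in the opposite
  direction \<open>- w\<close>, hence the occurrence of \<open>a_lo\<close>.
\<close>

definition U_safeable ::
  "real \<Rightarrow> real \<Rightarrow> real \<Rightarrow> real \<Rightarrow> real \<Rightarrow> real \<Rightarrow> real \<Rightarrow> real \<Rightarrow> real \<Rightarrow> real \<Rightarrow> real \<Rightarrow> bool"
where
  "U_safeable r_p h_p r_v a_lo a_up \<epsilon> r h v w v_up \<longleftrightarrow>
     U_impl r_p h_p r_v a_up \<epsilon> r h v w v_up \<and>
     (\<forall>h_ex v_ex.
        (0 \<le> \<epsilon> \<and> \<epsilon> < T_up a_up v w v_up \<and>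
           h_ex = w * a_up / 2 * \<epsilon>\<^sup>2 + v * \<epsilon> \<and> v_ex = w * a_up * \<epsilon> + v) \<or>
        (\<epsilon> \<ge> T_up a_up v w v_up \<and>
           h_ex = v_ex * \<epsilon> - w * (max 0 (w * (v_up - v)))\<^sup>2 / (2 * a_up) \<and>
           v_ex = w * max (w * v_up) (w * v))
        \<longrightarrow> (\<exists>v_up_ex. L_impl_inf r_p h_p r_v a_lo (r - r_v * \<epsilon>) (h - h_ex) v_ex (- w) v_up_ex))"

definition C_safeable ::
  "real \<Rightarrow> real \<Rightarrow> real \<Rightarrow> real \<Rightarrow> real \<Rightarrow> real \<Rightarrow> real \<Rightarrow> real \<Rightarrow> real \<Rightarrow> real \<Rightarrow> real \<Rightarrow> real \<Rightarrow> bool"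
where
  "C_safeable r_p h_p r_v a_lo a_up \<epsilon> r h v w v_lo v_up \<longleftrightarrow>
     w * v_lo \<le> w * v_up \<and>
     (L_safeable r_p h_p r_v a_lo \<epsilon> r h v w v_lo \<or>
      U_safeable r_p h_p r_v a_lo a_up \<epsilon> r h v w v_up)"


section \<open>The collision avoidance game\<close>

text \<open>
  The state variables.  The triple-valued bookkeeping variable \<open>adv\<close> is split into three
  real components.  The parameters are not modified by any game and are therefore
  plain real numbers rather than state variables.
\<close>

datatype acas_var =
    Var_r | Var_h | Var_v | Var_w | Var_vlo | Var_vup | Var_t | Var_ao
  | Var_adv_w | Var_adv_vlo | Var_adv_vup

definition alpha6 ::
  "real \<Rightarrow> real \<Rightarrow> real \<Rightarrow> real \<Rightarrow> real \<Rightarrow> real \<Rightarrow> real \<Rightarrow> acas_var game"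
where
  "alpha6 r_p h_p r_v a_lo a_up a_max \<epsilon> =
     (Var_w :=\<^sub>g (\<lambda>s. 1) \<union>\<^sub>g Var_w :=\<^sub>g (\<lambda>s. - 1)) ;;
     Var_vlo :=\<^sub>g * ;;
     Var_vup :=\<^sub>g * ;;
     Test (\<lambda>s. C_safeable r_p h_p r_v a_lo a_up \<epsilon>
                 (s Var_r) (s Var_h) (s Var_v) (s Var_w) (s Var_vlo) (s Var_vup)) ;;
     Var_adv_w :=\<^sub>g (\<lambda>s. s Var_w) ;;
     Var_adv_vlo :=\<^sub>g (\<lambda>s. s Var_vlo) ;;
     Var_adv_vup :=\<^sub>g (\<lambda>s. s Var_vup) ;;
     Var_t :=\<^sub>g (\<lambda>s. 0) ;;
     Loop
       (Dual (Var_ao :=\<^sub>g * ;; Test (\<lambda>s. - a_max \<le> s Var_ao \<and> s Var_ao \<le> a_max)) ;;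
        EvolveSplit
          [(Var_r, \<lambda>s. - r_v), (Var_h, \<lambda>s. - s Var_v), (Var_v, \<lambda>s. s Var_ao), (Var_t, \<lambda>s. 1)]
          (\<lambda>s. s Var_t \<le> \<epsilon>)
          (\<lambda>s. s Var_w * s Var_ao \<le> 0 \<or> s Var_w * s Var_v \<le> s Var_w * s Var_vup)
          (\<lambda>s. s Var_w * s Var_ao \<ge> 0 \<and> s Var_w * s Var_v \<ge> s Var_w * s Var_vup))"

end

theory Submission
  imports Defs
begin

text \<open>
  The opponent may restart the outer loop only in a safeable state, so safety itself is an
  invariant of the outer loop, and it remains to keep the state safe for time \<open>\<epsilon>\<close> after each
  advisory.  For this a constant acceleration suffices: \<open>w * a_lo\<close> if the lower bound is
  safeable, since it never falls below the nominal lower trajectory (the difference after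
  \<open>T_lo\<close> is a square), and \<open>0\<close> if the upper bound is safeable, since it never rises above the
  nominal upper trajectory.  The continuation beyond \<open>\<epsilon>\<close> is irrelevant for safety.
\<close>

text \<open>Coinduction: the box of a loop is a greatest fixed point, and \<open>I\<close> is a
  post-fixed point. Used for both the outer loop and the control loop.\<close>

lemma box_LoopI:
  assumes "s \<in> I" "I \<subseteq> X" "I \<subseteq> box \<alpha> I"
  shows "s \<in> box (Loop \<alpha>) X"
proof -
  have "I \<subseteq> gfp (\<lambda>Z. X \<inter> box \<alpha> Z)"
    using assms by (intro gfp_upperbound) auto
  with assms(1) show ?thesis by auto
qed

text \<open>Meant for first integrals of the flight equations: end states can then be computed
  without solving the equations.\<close>

lemma zero_derivative_endpoints:
  fixes f :: "real \<Rightarrow> real"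
  assumes "0 \<le> T"
    and deriv: "\<And>\<tau>. \<tau> \<in> {0..T} \<Longrightarrow> (f has_real_derivative 0) (at \<tau> within {0..T})"
  shows "f T = f 0"
proof (cases "T = 0")
  case False
  with \<open>0 \<le> T\<close> have "0 < T" by simp
  moreover have "continuous_on {0..T} f"
    using deriv by (rule DERIV_continuous_on)
  moreover have "DERIV f x :> 0" if "0 < x" "x < T" for x
    using deriv[of x] that at_within_Icc_at[of 0 x T] by simp
  ultimately show ?thesis by (rule DERIV_isconst_end)
qed simp

abbreviation flight_ode :: "real \<Rightarrow> (acas_var \<times> (acas_var state \<Rightarrow> real)) list"
where
  "flight_ode r_v \<equiv>
     [(Var_r, \<lambda>s. - r_v), (Var_h, \<lambda>s. - s Var_v), (Var_v, \<lambda>s. s Var_ao), (Var_t, \<lambda>s. 1)]"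

text \<open>First integrals: with \<open>v' = a\<close> and \<open>t' = 1\<close>, the third one has
  derivative \<open>- v + (a * t + v) - a * t = 0\<close>. They are expressed through the clock so
  that a round may start at any clock value.\<close>

lemma flight_ode_conserved:
  assumes sol: "solution (flight_ode r_v) D s T \<phi>" and "0 \<le> T" and "s Var_ao = a"
  shows "\<phi> T Var_r + r_v * \<phi> T Var_t = s Var_r + r_v * s Var_t"
    and "\<phi> T Var_v - a * \<phi> T Var_t = s Var_v - a * s Var_t"
    and "\<phi> T Var_h + \<phi> T Var_v * \<phi> T Var_t - a / 2 * (\<phi> T Var_t)\<^sup>2
         = s Var_h + s Var_v * s Var_t - a / 2 * (s Var_t)\<^sup>2"
    and "\<phi> T Var_t = s Var_t + T"
proof -
  have init: "\<phi> 0 = s" using sol by (simp add: solution_def)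
  have ao: "\<phi> \<tau> Var_ao = a" if "\<tau> \<in> {0..T}" for \<tau>
    using sol that \<open>s Var_ao = a\<close> by (auto simp: solution_def)
  have deriv:
    "((\<lambda>u. \<phi> u Var_r) has_real_derivative - r_v) (at \<tau> within {0..T})"
    "((\<lambda>u. \<phi> u Var_h) has_real_derivative - \<phi> \<tau> Var_v) (at \<tau> within {0..T})"
    "((\<lambda>u. \<phi> u Var_v) has_real_derivative a) (at \<tau> within {0..T})"
    "((\<lambda>u. \<phi> u Var_t) has_real_derivative 1) (at \<tau> within {0..T})"
    if "\<tau> \<in> {0..T}" for \<tau>
  proof -
    have "((\<lambda>u. \<phi> u x) has_real_derivative e (\<phi> \<tau>)) (at \<tau> within {0..T})"
      if "(x, e) \<in> set (flight_ode r_v)" for x e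
      using sol that \<open>\<tau> \<in> {0..T}\<close> unfolding solution_def by blast
    note this[of Var_r "\<lambda>s. - r_v"] this[of Var_h "\<lambda>s. - s Var_v"]
      this[of Var_v "\<lambda>s. s Var_ao"] this[of Var_t "\<lambda>s. 1"]
    then show
      "((\<lambda>u. \<phi> u Var_r) has_real_derivative - r_v) (at \<tau> within {0..T})"
      "((\<lambda>u. \<phi> u Var_h) has_real_derivative - \<phi> \<tau> Var_v) (at \<tau> within {0..T})"
      "((\<lambda>u. \<phi> u Var_v) has_real_derivative a) (at \<tau> within {0..T})"
      "((\<lambda>u. \<phi> u Var_t) has_real_derivative 1) (at \<tau> within {0..T})"
      by (simp_all add: ao[OF \<open>\<tau> \<in> {0..T}\<close>])
  qed
  have "\<phi> T Var_r + r_v * \<phi> T Var_t = \<phi> 0 Var_r + r_v * \<phi> 0 Var_t"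
    using \<open>0 \<le> T\<close>
    by (rule zero_derivative_endpoints) (rule derivative_eq_intros deriv refl | assumption | simp)+
  then show "\<phi> T Var_r + r_v * \<phi> T Var_t = s Var_r + r_v * s Var_t"
    by (simp add: init)
  have "\<phi> T Var_v - a * \<phi> T Var_t = \<phi> 0 Var_v - a * \<phi> 0 Var_t"
    using \<open>0 \<le> T\<close>
    by (rule zero_derivative_endpoints) (rule derivative_eq_intros deriv refl | assumption | simp)+
  then show "\<phi> T Var_v - a * \<phi> T Var_t = s Var_v - a * s Var_t"
    by (simp add: init)
  have "\<phi> T Var_h + \<phi> T Var_v * \<phi> T Var_t - a / 2 * (\<phi> T Var_t)\<^sup>2
        = \<phi> 0 Var_h + \<phi> 0 Var_v * \<phi> 0 Var_t - a / 2 * (\<phi> 0 Var_t)\<^sup>2"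
    using \<open>0 \<le> T\<close>
    by (rule zero_derivative_endpoints) (rule derivative_eq_intros deriv refl | assumption | simp)+
  then show "\<phi> T Var_h + \<phi> T Var_v * \<phi> T Var_t - a / 2 * (\<phi> T Var_t)\<^sup>2
        = s Var_h + s Var_v * s Var_t - a / 2 * (s Var_t)\<^sup>2"
    by (simp add: init)
  \<comment> \<open>This is \<open>f T = f 0\<close> for
    \<open>f u = \<phi> u Var_t - u\<close>.\<close>
  have "\<phi> T Var_t - T = \<phi> 0 Var_t - 0"
    using \<open>0 \<le> T\<close>
    by (rule zero_derivative_endpoints) (rule derivative_eq_intros deriv refl | assumption | simp)+
  then show "\<phi> T Var_t = s Var_t + T"
    by (simp add: init)
qed

text \<open>The flight from \<open>(r, h, v)\<close> at clock 0 under constant acceleration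
  \<open>a\<close>, cut off at \<epsilon>. Indexing by the clock makes the set independent of how
  the opponent splits the flight into rounds; \<open>Var_ao\<close> is left free because it is
  chosen anew in each round.\<close>

definition parabola ::
  "real \<Rightarrow> real \<Rightarrow> real \<Rightarrow> real \<Rightarrow> real \<Rightarrow> real \<Rightarrow> acas_var state set"
where
  "parabola r_v \<epsilon> a r h v =
     {s. 0 \<le> s Var_t \<and> s Var_t \<le> \<epsilon> \<and> s Var_r = r - r_v * s Var_t \<and>
         s Var_v = v + a * s Var_t \<and> s Var_h = h - (v * s Var_t + a / 2 * (s Var_t)\<^sup>2)}"

text \<open>\<open>Q\<close> is arbitrary so that both branches of the split evolution domain are
  covered.\<close>

lemma parabola_invariant:
  assumes "s \<in> parabola r_v \<epsilon> a r h v" "s Var_ao = a"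
  shows "s \<in> box (Evolve (flight_ode r_v) (\<lambda>s. s Var_t \<le> \<epsilon> \<and> Q s)) (parabola r_v \<epsilon> a r h v)"
  unfolding box.simps
proof (intro CollectI allI impI, elim conjE)
  fix T \<phi>
  assume "0 \<le> T" and sol: "solution (flight_ode r_v) (\<lambda>s. s Var_t \<le> \<epsilon> \<and> Q s) s T \<phi>"
  note conserved = flight_ode_conserved[OF sol \<open>0 \<le> T\<close> \<open>s Var_ao = a\<close>]
  have le: "\<phi> T Var_t \<le> \<epsilon>" using sol \<open>0 \<le> T\<close> by (auto simp: solution_def)
  have vel: "\<phi> T Var_v = v + a * \<phi> T Var_t"
    using conserved(2) assms(1) by (simp add: parabola_def)
  \<comment> \<open>Since the velocity at clock \<open>t\<close> is \<open>v + a * t\<close>, all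
    terms in \<open>t\<close> cancel, and the third first integral equals the initial
    \<open>h\<close> on the whole parabola.\<close>
  have "s Var_h + s Var_v * s Var_t - a / 2 * (s Var_t)\<^sup>2 = h"
    using assms(1) by (simp add: parabola_def power2_eq_square algebra_simps)
  then have "\<phi> T Var_h = h - (v * \<phi> T Var_t + a / 2 * (\<phi> T Var_t)\<^sup>2)"
    using conserved(3) unfolding vel by (simp add: power2_eq_square algebra_simps)
  then show "\<phi> T \<in> parabola r_v \<epsilon> a r h v"
    using conserved(1,4) assms(1) \<open>0 \<le> T\<close> le vel by (simp add: parabola_def)
qed

text \<open>The strategy repeats \<open>a\<close> in every round; the opponent then controls only
  durations, the domain branch and the number of rounds, none of which leaves the parabola.\<close>

lemma constant_acceleration_wins:
  assumes "s Var_t = 0" "0 \<le> \<epsilon>" "- a_max \<le> a" "a \<le> a_max"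
    and safe: "\<And>t. 0 \<le> t \<Longrightarrow> t \<le> \<epsilon> \<Longrightarrow>
      r_p < \<bar>s Var_r - r_v * t\<bar> \<or> h_p < \<bar>s Var_h - (s Var_v * t + a / 2 * t\<^sup>2)\<bar>"
  shows "s \<in> box
    (Loop
      (Dual (Var_ao :=\<^sub>g * ;; Test (\<lambda>s. - a_max \<le> s Var_ao \<and> s Var_ao \<le> a_max)) ;;
       EvolveSplit (flight_ode r_v) (\<lambda>s. s Var_t \<le> \<epsilon>) Q1 Q2))
    {s. r_p < \<bar>s Var_r\<bar> \<or> h_p < \<bar>s Var_h\<bar>}"
proof (rule box_LoopI)
  let ?I = "parabola r_v \<epsilon> a (s Var_r) (s Var_h) (s Var_v)"
  show "s \<in> ?I" using assms by (simp add: parabola_def)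
  show "?I \<subseteq> {s. r_p < \<bar>s Var_r\<bar> \<or> h_p < \<bar>s Var_h\<bar>}"
  proof
    fix u assume "u \<in> ?I"
    then show "u \<in> {s. r_p < \<bar>s Var_r\<bar> \<or> h_p < \<bar>s Var_h\<bar>}"
      using safe[of "u Var_t"] by (simp add: parabola_def)
  qed
  show "?I \<subseteq> box
    (Dual (Var_ao :=\<^sub>g * ;; Test (\<lambda>s. - a_max \<le> s Var_ao \<and> s Var_ao \<le> a_max)) ;;
     EvolveSplit (flight_ode r_v) (\<lambda>s. s Var_t \<le> \<epsilon>) Q1 Q2) ?I"
  proof
    fix u assume "u \<in> ?I"
    then have "u(Var_ao := a) \<in> ?I" by (simp add: parabola_def)
    then have "u(Var_ao := a) \<in> box (EvolveSplit (flight_ode r_v) (\<lambda>s. s Var_t \<le> \<epsilon>) Q1 Q2) ?I"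
      unfolding EvolveSplit_def box.simps(6) by (intro IntI parabola_invariant fun_upd_same)
    with assms(3,4) show "u \<in> box
      (Dual (Var_ao :=\<^sub>g * ;; Test (\<lambda>s. - a_max \<le> s Var_ao \<and> s Var_ao \<le> a_max)) ;;
       EvolveSplit (flight_ode r_v) (\<lambda>s. s Var_t \<le> \<epsilon>) Q1 Q2) ?I"
      by (simp only: box.simps(5,8) dia.simps(2,3,5) mem_Collect_eq) (intro exI[of _ a], simp)
  qed
qed

text \<open>After \<open>T_lo\<close> the nominal path is a line: the tangent to the parabola at
  \<open>T_lo\<close> if speed must still be gained in direction \<open>w\<close>, otherwise a line
  from the start that climbs, in direction \<open>w\<close>, no faster than the initial
  velocity.\<close>

lemma A_lo_below_parabola:
  assumes "0 < a_lo" "w = - 1 \<or> w = 1" "0 \<le> t"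
  obtains h_n where "A_lo a_lo v w v_lo h_n t" "w * h_n \<le> w * (v * t + w * a_lo / 2 * t\<^sup>2)"
proof (cases "t < T_lo a_lo v w v_lo")
  case True
  then show ?thesis
    using that[of "w * a_lo / 2 * t\<^sup>2 + v * t"] \<open>0 \<le> t\<close> by (simp add: A_lo_def add.commute)
next
  case False
  define m where "m = max 0 (w * (v_lo - v))"
  have "w * v_lo - w * v \<le> m" by (simp add: m_def algebra_simps)
  then have "(w * v_lo - w * v) * t \<le> m * t" using \<open>0 \<le> t\<close> by (rule mult_right_mono)
  \<comment> \<open>For \<open>m > 0\<close> this square is the exact gap between parabola and
    line.\<close>
  moreover have "0 \<le> (a_lo * t - m)\<^sup>2 / (2 * a_lo)" using \<open>0 < a_lo\<close> by simp
  then have "m * t \<le> a_lo / 2 * t\<^sup>2 + m\<^sup>2 / (2 * a_lo)"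
    using \<open>0 < a_lo\<close> by (simp add: field_simps power2_eq_square)
  ultimately have "w * v_lo * t - m\<^sup>2 / (2 * a_lo) \<le> w * v * t + a_lo / 2 * t\<^sup>2"
    by (simp add: algebra_simps)
  then have "w * (v_lo * t - w * m\<^sup>2 / (2 * a_lo)) \<le> w * (v * t + w * a_lo / 2 * t\<^sup>2)"
    using assms(2) by auto
  then show ?thesis using that False by (simp add: A_lo_def m_def)
qed

text \<open>
  The sign of \<open>a_up\<close> is not constrained, since \<open>c\<close> may be negative.  If \<open>a_up \<le> 0\<close> (including
  \<open>a_up = 0\<close>, where division yields \<open>0\<close>), only the second phase of the nominal trajectory
  occurs for \<open>t \<ge> 0\<close>.
\<close>

lemma A_up_above_line:
  assumes "w = - 1 \<or> w = 1" "0 \<le> t"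
  obtains h_n where "A_up a_up v w v_up h_n t" "w * (v * t) \<le> w * h_n"
proof (cases "t < T_up a_up v w v_up")
  case True
  then have "0 < a_up"
    using \<open>0 \<le> t\<close> divide_nonneg_nonpos[of "max 0 (w * (v_up - v))" a_up]
    by (fastforce simp: T_up_def not_less[symmetric])
  then have "0 \<le> a_up / 2 * t\<^sup>2" by simp
  with assms(1) have "w * (v * t) \<le> w * (w * a_up / 2 * t\<^sup>2 + v * t)" by auto
  with True that show ?thesis using \<open>0 \<le> t\<close> by (simp add: A_up_def)
next
  case False
  define m where "m = max 0 (w * (v_up - v))"
  have max: "max (w * v_up) (w * v) = w * v + m" by (simp add: m_def algebra_simps max_def)
  have "0 \<le> m" by (simp add: m_def)
  \<comment> \<open>With the maximum rewritten as \<open>w * v + m\<close>, the claim reduces to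
    this bound. For positive \<open>a_up\<close> it follows from \<open>m / a_up \<le> t\<close>,
    with a factor 2 to spare.\<close>
  have "m\<^sup>2 / (2 * a_up) \<le> m * t"
  proof (cases "0 < a_up")
    case True
    with False have "m \<le> t * a_up" by (simp add: T_up_def m_def not_less field_simps)
    then have "m * m \<le> m * (t * a_up)" using \<open>0 \<le> m\<close> by (rule mult_left_mono)
    also have "\<dots> \<le> 2 * (m * (t * a_up))" using \<open>0 \<le> m\<close> \<open>0 \<le> t\<close> True by simp
    finally show ?thesis using True by (simp add: field_simps power2_eq_square)
  next
    case False
    then have "m\<^sup>2 / (2 * a_up) \<le> 0" by (intro divide_nonneg_nonpos) auto
    also have "0 \<le> m * t" using \<open>0 \<le> m\<close> \<open>0 \<le> t\<close> by simp
    finally show ?thesis .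
  qed
  then have "w * (v * t) \<le> w * (w * max (w * v_up) (w * v) * t - w * m\<^sup>2 / (2 * a_up))"
    using assms(1) unfolding max by (auto simp: algebra_simps)
  with False that show ?thesis by (simp add: A_up_def m_def)
qed

text \<open>The nominal path clears the intruder in direction \<open>w\<close> (lower bound) or
  against it (upper bound). The chosen flight lies at least as far on the same side, so its absolute
  distance is at least as large.\<close>

lemma C_safeable_constant_acceleration:
  assumes "C_safeable r_p h_p r_v a_lo a_up \<epsilon> r h v w v_lo v_up"
    and "0 < a_lo" "a_lo \<le> a_max" "w = - 1 \<or> w = 1"
  obtains a where "- a_max \<le> a" "a \<le> a_max"
    and "\<And>t. 0 \<le> t \<Longrightarrow> t \<le> \<epsilon> \<Longrightarrow>
      r_p < \<bar>r - r_v * t\<bar> \<or> h_p < \<bar>h - (v * t + a / 2 * t\<^sup>2)\<bar>"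
proof -
  consider "L_impl r_p h_p r_v a_lo \<epsilon> r h v w v_lo" | "U_impl r_p h_p r_v a_up \<epsilon> r h v w v_up"
    using assms(1) by (auto simp: C_safeable_def L_safeable_def U_safeable_def)
  then show ?thesis
  proof cases
    case 1
    have "r_p < \<bar>r - r_v * t\<bar> \<or> h_p < \<bar>h - (v * t + w * a_lo / 2 * t\<^sup>2)\<bar>"
      if t: "0 \<le> t" "t \<le> \<epsilon>" for t
    proof -
      let ?d = "v * t + w * a_lo / 2 * t\<^sup>2"
      obtain h_n where "A_lo a_lo v w v_lo h_n t" and le: "w * h_n \<le> w * ?d"
        using A_lo_below_parabola[OF assms(2,4) t(1)] .
      with 1 t(2) have "r_p < \<bar>r - r_v * t\<bar> \<or> h_p < w * (h_n - h)"
        by (auto simp: L_impl_def)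
      moreover have "w * (h_n - h) \<le> w * (?d - h)" using le by (simp add: right_diff_distrib)
      moreover have "w * (?d - h) \<le> \<bar>h - ?d\<bar>" using assms(4) by auto
      ultimately show ?thesis by linarith
    qed
    then show ?thesis using that[of "w * a_lo"] assms(2-4) by auto
  next
    case 2
    have "r_p < \<bar>r - r_v * t\<bar> \<or> h_p < \<bar>h - v * t\<bar>" if t: "0 \<le> t" "t \<le> \<epsilon>" for t
    proof -
      obtain h_n where "A_up a_up v w v_up h_n t" and le: "w * (v * t) \<le> w * h_n"
        using A_up_above_line[OF assms(4) t(1)] .
      with 2 t(2) have "r_p < \<bar>r - r_v * t\<bar> \<or> h_p < w * (h - h_n)"
        by (auto simp: U_impl_def)
      moreover have "w * (h - h_n) \<le> w * (h - v * t)" using le by (simp add: right_diff_distrib)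
      moreover have "w * (h - v * t) \<le> \<bar>h - v * t\<bar>" using assms(4) by auto
      ultimately show ?thesis by linarith
    qed
    then show ?thesis using that[of 0] assms(2,3) by auto
  qed
qed

theorem theorem8p2:
  fixes r_p h_p r_v a_lo a_up a_max c \<epsilon> :: real
  shows "valid (\<lambda>s.
      r_p \<ge> 0 \<and> h_p > 0 \<and> r_v \<ge> 0 \<and> a_lo > 0 \<and> (s Var_w = - 1 \<or> s Var_w = 1) \<and>
      a_up > a_lo + 2 * c \<and> \<epsilon> \<ge> 0 \<and> a_max \<ge> a_lo \<and>
      C_safeable r_p h_p r_v a_lo a_up \<epsilon>
        (s Var_r) (s Var_h) (s Var_v) (s Var_w) (s Var_vlo) (s Var_vup)
      \<longrightarrow>
      Box (Loop (alpha6 r_p h_p r_v a_lo a_up a_max \<epsilon>))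
          (\<lambda>s'. \<bar>s' Var_r\<bar> > r_p \<or> \<bar>s' Var_h\<bar> > h_p) s)"
  unfolding valid_def Box_def
proof (intro allI impI, elim conjE)
  fix s :: "acas_var state"
  assume "0 < a_lo" "0 \<le> \<epsilon>" "a_lo \<le> a_max" and w: "s Var_w = - 1 \<or> s Var_w = 1"
    and C: "C_safeable r_p h_p r_v a_lo a_up \<epsilon>
        (s Var_r) (s Var_h) (s Var_v) (s Var_w) (s Var_vlo) (s Var_vup)"
  let ?safe = "{s. \<bar>s Var_r\<bar> > r_p \<or> \<bar>s Var_h\<bar> > h_p} :: acas_var state set"
  show "s \<in> box (Loop (alpha6 r_p h_p r_v a_lo a_up a_max \<epsilon>)) ?safe"
  proof (rule box_LoopI)
    obtain a where "\<And>t. 0 \<le> t \<Longrightarrow> t \<le> \<epsilon> \<Longrightarrow>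
        r_p < \<bar>s Var_r - r_v * t\<bar> \<or> h_p < \<bar>s Var_h - (s Var_v * t + a / 2 * t\<^sup>2)\<bar>"
      using C_safeable_constant_acceleration[OF C \<open>0 < a_lo\<close> \<open>a_lo \<le> a_max\<close> w] by metis
    from this[of 0] show "s \<in> ?safe" using \<open>0 \<le> \<epsilon>\<close> by simp
    \<comment> \<open>Here \<open>w\<close>, \<open>v_lo\<close>, \<open>v_up\<close> are values
      rather than components of \<open>u\<close>, because simplifying the assignments of
      \<open>alpha6\<close> leaves plain numbers in \<open>C_safeable\<close>.\<close>
    have win: "u \<in> box
        (Loop
          (Dual (Var_ao :=\<^sub>g * ;; Test (\<lambda>s. - a_max \<le> s Var_ao \<and> s Var_ao \<le> a_max)) ;;
           EvolveSplit (flight_ode r_v) (\<lambda>s. s Var_t \<le> \<epsilon>) Q1 Q2)) ?safe"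
      if C: "C_safeable r_p h_p r_v a_lo a_up \<epsilon> (u Var_r) (u Var_h) (u Var_v) w v_lo v_up"
        and w: "w = - 1 \<or> w = 1" and t: "u Var_t = 0"
      for u w v_lo v_up Q1 Q2
      using C \<open>0 < a_lo\<close> \<open>a_lo \<le> a_max\<close> w
      by (rule C_safeable_constant_acceleration)
        (rule constant_acceleration_wins[where s = u, OF t \<open>0 \<le> \<epsilon>\<close>])
    show "?safe \<subseteq> box (alpha6 r_p h_p r_v a_lo a_up a_max \<epsilon>) ?safe"
      \<comment> \<open>The inner loop must stay folded for \<open>win\<close> to match.\<close>
      by (auto simp: alpha6_def simp del: box.simps(7) intro!: win)
  qed simp
qed

end
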